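(* There exist absolute constants $C>0$ and $T_0>0$ such that for all $k>0$, $\frac12\le\sigma\le1$, $0<\delta\le\frac12$ and $T\ge T_0$ we have $$\int_{T-\delta}^{T+\delta}|\zeta(\sigma+it)|^k\,dt\ \ge\ 2\delta\,T^{-Ck\log(e/\delta)}.$$
   Context: $\zeta(s)$ is the Riemann zeta-function, and $e$ is the base of natural logarithms. *)

theory Defs
  imports "HOL-Complex_Analysis.Complex_Analysis"
begin

definition is_zeta_continuation :: "(complex \<Rightarrow> complex) \<Rightarrow> bool" where
  "is_zeta_continuation f \<longleftrightarrow>
     f holomorphic_on - {1} \<and>
     (\<forall>s. Re s > 1 \<longrightarrow> (\<lambda>n. 1 / of_nat (Suc n) powr s) sums f s)"

text \<open>
  The Riemann zeta-function is the analytic continuation of the Dirichlet series to the plane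
  without the pole at \<open>1\<close>. The value at the pole is a convention, needed only to make the
  description definite; existence and uniqueness are proved below.
\<close>

definition zeta :: "complex \<Rightarrow> complex" where
  "zeta = (THE f. is_zeta_continuation f \<and> f 1 = 0)"

lemma is_zeta_continuation_unique:
  assumes "is_zeta_continuation f" "is_zeta_continuation g" "s \<noteq> 1"
  shows "f s = g s"
proof -
  have conn: "connected (- {1 :: complex})"
    by (intro connected_punctured_universe) auto
  have "f s - g s = 0"
  proof (rule analytic_continuation_open[where s = "{s. Re s > 1}" and s' = "- {1}"
          and f = "\<lambda>s. f s - g s" and g = "\<lambda>_. 0"])
    show "open {s. 1 < Re s}" by (rule open_halfspace_Re_gt)
    show "{s. 1 < Re s} \<noteq> {}" by (auto intro: exI[of _ 2])
    show "connected (- {1 :: complex})" by (rule conn)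
    show "{s. 1 < Re s} \<subseteq> - {1}" by auto
    show "(\<lambda>s. f s - g s) holomorphic_on - {1}"
      using assms unfolding is_zeta_continuation_def by (intro holomorphic_intros) auto
    show "f z - g z = 0" if "z \<in> {s. 1 < Re s}" for z
      using assms that sums_unique2[of "\<lambda>n. 1 / of_nat (Suc n) powr z" "f z" "g z"]
      unfolding is_zeta_continuation_def by simp
    show "s \<in> - {1}" using assms by simp
  qed auto
  thus ?thesis by simp
qed

lemma holomorphic_on_suminf:
  fixes f :: "nat \<Rightarrow> complex \<Rightarrow> complex"
  assumes "open S" and "\<And>n. f n holomorphic_on S"
    and bound: "\<And>x. x \<in> S \<Longrightarrow> \<exists>d M. 0 < d \<and> cball x d \<subseteq> S \<and> summable M \<and>
                       (\<forall>n. \<forall>y\<in>cball x d. norm (f n y) \<le> M n)"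
  shows "(\<lambda>x. \<Sum>n. f n x) holomorphic_on S"
proof (rule holomorphic_uniform_sequence[where f = "\<lambda>n x. \<Sum>i<n. f i x"])
  show "open S" by fact
  show "(\<lambda>x. \<Sum>i<n. f i x) holomorphic_on S" for n
    using assms(2) by (intro holomorphic_intros)
  fix x assume "x \<in> S"
  from bound[OF this] obtain d M where
    "0 < d" "cball x d \<subseteq> S" "summable M" "\<forall>n. \<forall>y\<in>cball x d. norm (f n y) \<le> M n"
    by blast
  thus "\<exists>d>0. cball x d \<subseteq> S \<and>
          uniform_limit (cball x d) (\<lambda>n x. \<Sum>i<n. f i x) (\<lambda>x. \<Sum>n. f n x) sequentially"
    by (intro exI[of _ d] conjI Weierstrass_m_test) auto
qed

definition zeta_series :: "complex \<Rightarrow> complex" where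
  "zeta_series s = (\<Sum>n. 1 / of_nat (Suc n) powr s)"

lemma norm_Suc_powr: "norm (of_nat (Suc n) powr s :: complex) = real (Suc n) powr Re s"
  by (subst norm_powr_real_powr) (auto simp del: of_nat_Suc)

lemma summable_Suc_powr: "c > 1 \<Longrightarrow> summable (\<lambda>n. real (Suc n) powr (- c))"
  by (subst summable_Suc_iff[where f = "\<lambda>n. real n powr (- c)"])
     (simp add: summable_real_powr_iff)

lemma sums_zeta_series:
  assumes "Re s > 1"
  shows "(\<lambda>n. of_nat (Suc n) powr (- s)) sums zeta_series s"
proof -
  have "summable (\<lambda>n. of_nat (Suc n) powr (- s) :: complex)"
    by (rule summable_norm_cancel, subst norm_Suc_powr)
       (use summable_Suc_powr[OF assms] in simp)
  thus ?thesis
    unfolding zeta_series_def powr_minus_divide by (rule summable_sums)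
qed

lemma holomorphic_zeta_series: "zeta_series holomorphic_on {s. Re s > 1}"
proof -
  have "(\<lambda>s. \<Sum>n. of_nat (Suc n) powr (- s)) holomorphic_on {s. Re s > 1}"
  proof (rule holomorphic_on_suminf)
    show "open {s. 1 < Re s}" by (rule open_halfspace_Re_gt)
    show "(\<lambda>s. of_nat (Suc n) powr (- s)) holomorphic_on {s. 1 < Re s}" for n
      by (intro holomorphic_intros)
    fix x assume x: "x \<in> {s. 1 < Re s}"
    define d where "d = (Re x - 1) / 2"
    have Re: "Re y \<ge> 1 + d" if "y \<in> cball x d" for y
      using abs_Re_le_cmod[of "x - y"] that by (simp add: d_def dist_norm field_simps)
    have d: "d > 0" using x by (simp add: d_def)
    show "\<exists>d M. 0 < d \<and> cball x d \<subseteq> {s. 1 < Re s} \<and> summable M \<and>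
            (\<forall>n. \<forall>y\<in>cball x d. norm (of_nat (Suc n) powr (- y) :: complex) \<le> M n)"
    proof (intro exI[of _ d] exI[of _ "\<lambda>n. real (Suc n) powr (- (1 + d))"] conjI allI ballI)
      show "cball x d \<subseteq> {s. 1 < Re s}" using Re d by force
      show "summable (\<lambda>n. real (Suc n) powr (- (1 + d)))"
        using d by (intro summable_Suc_powr) auto
      fix n y assume "y \<in> cball x d"
      thus "norm (of_nat (Suc n) powr (- y) :: complex) \<le> real (Suc n) powr (- (1 + d))"
        using Re[of y] by (subst norm_Suc_powr) (auto intro!: powr_mono)
    qed fact
  qed
  thus ?thesis
    by (simp add: zeta_series_def[abs_def] powr_minus_divide del: of_nat_Suc)
qed

text \<open>
  Existence: expand \<open>(n + 2) powr (1 - s)\<close> to order \<open>m\<close> around \<open>n + 1\<close> and sum over \<open>n\<close>. The left-hand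
  sides telescope, the remainders sum to a function holomorphic for \<open>Re s > 1 - m\<close>, and the
  resulting recurrence expresses \<open>(s - 1) * zeta s\<close> through its values at \<open>s + 1, s + 2, \<dots>\<close>.
\<close>

definition falling :: "nat \<Rightarrow> complex \<Rightarrow> complex" where
  "falling i s = (\<Prod>l<i. 1 - s - of_nat l)"

definition taylor_error :: "nat \<Rightarrow> nat \<Rightarrow> complex \<Rightarrow> complex" where
  "taylor_error m n s = of_nat (Suc (Suc n)) powr (1 - s) -
     (\<Sum>i\<le>m. falling i s / fact i * of_nat (Suc n) powr (1 - s - of_nat i))"

lemma norm_taylor_error_le:
  assumes "Re s + real m \<ge> c" "c \<ge> 0"
  shows "norm (taylor_error m n s) \<le>
           norm (falling (Suc m) s) * real (Suc n) powr (- c) / fact m"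
proof -
  define f where "f = (\<lambda>i x. falling i s * x powr (1 - s - of_nat i))"
  define a where "a = complex_of_nat (Suc n)"
  define S where "S = closed_segment a (a + 1)"
  have S: "\<exists>r\<ge>real (Suc n). x = of_real r" if "x \<in> S" for x
  proof -
    from that obtain u where "0 \<le> u" "u \<le> 1" "x = (1 - u) *\<^sub>R a + u *\<^sub>R (a + 1)"
      unfolding S_def in_segment by blast
    hence "x = of_real (real (Suc n) + u)"
      by (simp add: a_def scaleR_conv_of_real algebra_simps)
    thus ?thesis using \<open>0 \<le> u\<close> by (intro exI[of _ "real (Suc n) + u"]) auto
  qed
  have "norm (f 0 (a + 1) - (\<Sum>i\<le>m. f i a * ((a + 1) - a) ^ i / fact i))
          \<le> (norm (falling (Suc m) s) * real (Suc n) powr (- c)) *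
              norm ((a + 1) - a) ^ Suc m / fact m"
  proof (rule complex_Taylor[where S = S])
    show "convex S" by (simp add: S_def)
    show "a \<in> S" "a + 1 \<in> S" by (simp_all add: S_def)
  next
    fix i x assume "x \<in> S"
    then obtain r where r: "r \<ge> real (Suc n)" "x = of_real r" using S by blast
    hence "x \<notin> \<real>\<^sub>\<le>\<^sub>0" by (auto simp: complex_nonpos_Reals_iff)
    hence "((\<lambda>x. falling i s * x powr (1 - s - of_nat i)) has_field_derivative
             falling i s * ((1 - s - of_nat i) * x powr (1 - s - of_nat i - 1))) (at x)"
      by (auto intro!: derivative_eq_intros)
    also have "falling i s * ((1 - s - of_nat i) * x powr (1 - s - of_nat i - 1)) = f (Suc i) x"
      by (simp add: f_def falling_def algebra_simps)
    finally show "(f i has_field_derivative f (Suc i) x) (at x within S)"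
      unfolding f_def by (rule has_field_derivative_at_within)
  next
    fix x assume "x \<in> S"
    then obtain r where r: "r \<ge> real (Suc n)" "x = of_real r" using S by blast
    have "norm (x powr (1 - s - of_nat (Suc m))) = r powr (- (Re s + real m))"
      using r by (subst norm_powr_real_powr) (auto simp: algebra_simps)
    also have "\<dots> \<le> r powr (- c)"
      using r assms by (intro powr_mono) auto
    also have "\<dots> \<le> real (Suc n) powr (- c)"
      using r assms by (intro powr_mono2') auto
    finally show "norm (f (Suc m) x) \<le> norm (falling (Suc m) s) * real (Suc n) powr (- c)"
      unfolding f_def norm_mult by (intro mult_left_mono) auto
  qed
  moreover have "f 0 (a + 1) - (\<Sum>i\<le>m. f i a * ((a + 1) - a) ^ i / fact i) = taylor_error m n s"
    by (simp add: f_def a_def taylor_error_def falling_def add_ac)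
  ultimately show ?thesis by simp
qed

lemma summable_taylor_error:
  assumes "Re s + real m > 1"
  shows "summable (\<lambda>n. taylor_error m n s)"
proof (rule summable_comparison_test')
  show "summable (\<lambda>n. norm (falling (Suc m) s) * real (Suc n) powr (- (Re s + real m)) / fact m)"
    by (intro summable_divide summable_mult summable_Suc_powr assms)
  show "norm (taylor_error m n s) \<le>
          norm (falling (Suc m) s) * real (Suc n) powr (- (Re s + real m)) / fact m"
    if "n \<ge> 0" for n
    using assms by (intro norm_taylor_error_le) auto
qed

lemma holomorphic_suminf_taylor_error:
  "(\<lambda>s. \<Sum>n. taylor_error m n s) holomorphic_on {s. Re s > 1 - real m}"
proof (rule holomorphic_on_suminf)
  show "open {s. 1 - real m < Re s}" by (rule open_halfspace_Re_gt)
  show "taylor_error m n holomorphic_on {s. 1 - real m < Re s}" for n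
    unfolding taylor_error_def[abs_def] falling_def
    by (intro holomorphic_intros) (auto simp del: of_nat_Suc)
  fix x assume x: "x \<in> {s. 1 - real m < Re s}"
  define d where "d = (Re x + real m - 1) / 2"
  have Re: "Re y + real m \<ge> 1 + d" if "y \<in> cball x d" for y
    using abs_Re_le_cmod[of "x - y"] that by (simp add: d_def dist_norm field_simps)
  have d: "d > 0" using x by (simp add: d_def)
  have "continuous_on (cball x d) (\<lambda>s. falling (Suc m) s)"
    unfolding falling_def by (intro continuous_intros)
  hence "bounded (falling (Suc m) ` cball x d)"
    by (intro compact_imp_bounded compact_continuous_image) auto
  then obtain B where B: "\<And>y. y \<in> cball x d \<Longrightarrow> norm (falling (Suc m) y) \<le> B"
    unfolding bounded_iff by blast
  show "\<exists>d M. 0 < d \<and> cball x d \<subseteq> {s. 1 - real m < Re s} \<and> summable M \<and>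
          (\<forall>n. \<forall>y\<in>cball x d. norm (taylor_error m n y) \<le> M n)"
  proof (intro exI[of _ d] exI[of _ "\<lambda>n. B * real (Suc n) powr (- (1 + d)) / fact m"]
               conjI allI ballI)
    show "cball x d \<subseteq> {s. 1 - real m < Re s}" using Re d by force
    show "summable (\<lambda>n. B * real (Suc n) powr (- (1 + d)) / fact m)"
      using d by (intro summable_divide summable_mult summable_Suc_powr) auto
    fix n y assume y: "y \<in> cball x d"
    have "norm (taylor_error m n y) \<le>
            norm (falling (Suc m) y) * real (Suc n) powr (- (1 + d)) / fact m"
      using Re[OF y] d by (intro norm_taylor_error_le) auto
    also have "\<dots> \<le> B * real (Suc n) powr (- (1 + d)) / fact m"
      by (intro divide_right_mono mult_right_mono B y) auto
    finally show "norm (taylor_error m n y) \<le> B * real (Suc n) powr (- (1 + d)) / fact m" .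
  qed fact
qed

lemma zeta_series_recurrence:
  assumes s: "Re s > 1"
  shows "(\<Sum>n. taylor_error m n s) =
           (\<Sum>j<m. falling j s / fact (Suc j) * ((s + of_nat j - 1) * zeta_series (s + of_nat j))) - 1"
proof -
  have "(\<lambda>n. of_nat (Suc n) powr (1 - s) :: complex) \<longlonglongrightarrow> 0"
  proof (rule tendsto_norm_zero_cancel, subst norm_Suc_powr)
    have "(\<lambda>n. real n powr Re (1 - s)) \<longlonglongrightarrow> 0"
      using s by (intro tendsto_neg_powr filterlim_real_sequentially) auto
    thus "(\<lambda>n. real (Suc n) powr Re (1 - s)) \<longlonglongrightarrow> 0" by (rule LIMSEQ_Suc)
  qed
  from telescope_sums[OF this]
  have tel: "(\<lambda>n. of_nat (Suc (Suc n)) powr (1 - s) - of_nat (Suc n) powr (1 - s)) sums (- 1 :: complex)"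
    by simp
  have "(\<lambda>n. (\<Sum>j<m. falling (Suc j) s / fact (Suc j) * of_nat (Suc n) powr (- (s + of_nat j))))
          sums (\<Sum>j<m. falling (Suc j) s / fact (Suc j) * zeta_series (s + of_nat j))"
    using s by (intro sums_sum sums_mult sums_zeta_series) auto
  from sums_diff[OF tel this]
  have "(\<lambda>n. taylor_error m n s) sums
          (- 1 - (\<Sum>j<m. falling (Suc j) s / fact (Suc j) * zeta_series (s + of_nat j)))"
  proof (rule sums_cong[THEN iffD1, rotated])
    fix n
    show "of_nat (Suc (Suc n)) powr (1 - s) - of_nat (Suc n) powr (1 - s) -
            (\<Sum>j<m. falling (Suc j) s / fact (Suc j) * of_nat (Suc n) powr (- (s + of_nat j))) =
          taylor_error m n s"
      unfolding taylor_error_def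
      by (subst sum.atMost_shift) (simp add: falling_def add_ac diff_diff_eq del: fact_Suc prod.lessThan_Suc)
  qed
  hence "(\<Sum>n. taylor_error m n s) =
           - 1 - (\<Sum>j<m. falling (Suc j) s / fact (Suc j) * zeta_series (s + of_nat j))"
    by (simp add: sums_iff)
  also have "(\<Sum>j<m. falling (Suc j) s / fact (Suc j) * zeta_series (s + of_nat j)) =
     - (\<Sum>j<m. falling j s / fact (Suc j) * ((s + of_nat j - 1) * zeta_series (s + of_nat j)))"
    unfolding sum_negf[symmetric]
  proof (rule sum.cong)
    fix j
    have "falling (Suc j) s = - (falling j s * (s + of_nat j - 1))"
      by (simp add: falling_def algebra_simps)
    thus "falling (Suc j) s / fact (Suc j) * zeta_series (s + of_nat j) =
            - (falling j s / fact (Suc j) * ((s + of_nat j - 1) * zeta_series (s + of_nat j)))"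
      by (simp del: fact_Suc)
  qed simp
  finally show ?thesis by simp
qed

lemma zeta_continuation_halfplane:
  "\<exists>G. G holomorphic_on {s. Re s > 1 - real q} \<and>
       (\<forall>s. Re s > 1 \<longrightarrow> G s = (s - 1) * zeta_series s)"
proof (induction q)
  case 0
  have "(\<lambda>s. (s - 1) * zeta_series s) holomorphic_on {s. Re s > 1}"
    by (intro holomorphic_intros holomorphic_zeta_series)
  thus ?case by (intro exI[of _ "\<lambda>s. (s - 1) * zeta_series s"]) auto
next
  case (Suc q)
  then obtain G where G: "G holomorphic_on {s. Re s > 1 - real q}"
    "\<And>s. Re s > 1 \<Longrightarrow> G s = (s - 1) * zeta_series s" by blast
  define m where "m = Suc q"
  define F where "F = (\<lambda>s. 1 + (\<Sum>n. taylor_error (Suc m) n s) -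
    (\<Sum>j<m. falling (Suc j) s / fact (Suc (Suc j)) * G (s + of_nat (Suc j))))"
  show ?case
  proof (intro exI[of _ F] conjI allI impI)
    have "(\<lambda>s. \<Sum>n. taylor_error (Suc m) n s) holomorphic_on {s. Re s > 1 - real (Suc q)}"
      by (rule holomorphic_on_subset[OF holomorphic_suminf_taylor_error]) (auto simp: m_def)
    moreover have "(\<lambda>s. G (s + of_nat (Suc j))) holomorphic_on {s. Re s > 1 - real (Suc q)}" for j
      by (rule holomorphic_on_compose_gen[OF _ G(1), unfolded o_def])
         (auto intro!: holomorphic_intros)
    moreover have "(\<lambda>s. falling j s) holomorphic_on {s. Re s > 1 - real (Suc q)}" for j
      unfolding falling_def by (intro holomorphic_intros)
    ultimately show "F holomorphic_on {s. Re s > 1 - real (Suc q)}"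
      unfolding F_def by (intro holomorphic_intros) auto
  next
    fix s :: complex assume s: "Re s > 1"
    have "(\<Sum>j<m. falling (Suc j) s / fact (Suc (Suc j)) * G (s + of_nat (Suc j))) =
          (\<Sum>j<m. falling (Suc j) s / fact (Suc (Suc j)) *
             ((s + of_nat (Suc j) - 1) * zeta_series (s + of_nat (Suc j))))"
      using s by (intro sum.cong refl) (simp add: G(2) del: fact_Suc)
    thus "F s = (s - 1) * zeta_series s"
      unfolding F_def zeta_series_recurrence[OF s] sum.lessThan_Suc_shift
      by (simp add: falling_def del: fact_Suc prod.lessThan_Suc)
  qed
qed

lemma is_zeta_continuation_exists: "\<exists>f. is_zeta_continuation f"
proof -
  define H where "H = (\<lambda>q. {s :: complex. Re s > 1 - real q})"
  obtain G where G: "\<And>q. G q holomorphic_on H q"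
    "\<And>q s. Re s > 1 \<Longrightarrow> G q s = (s - 1) * zeta_series s"
    using zeta_continuation_halfplane unfolding H_def by metis
  have openH: "open (H q)" and connH: "connected (H q)" for q
    unfolding H_def by (auto intro: open_halfspace_Re_gt convex_connected convex_halfspace_Re_gt)
  have agree: "G p s = G q s" if "p \<le> q" "s \<in> H p" for p q s
  proof (rule analytic_continuation_open[where s = "{s. Re s > 1}" and s' = "H p"
          and f = "G p" and g = "G q"])
    show "G p holomorphic_on H p" by (rule G)
    show "G q holomorphic_on H p"
      by (rule holomorphic_on_subset[OF G(1)]) (use that in \<open>auto simp: H_def\<close>)
    show "{s. 1 < Re s} \<noteq> {}" by (auto intro: exI[of _ 2])
    show "{s. 1 < Re s} \<subseteq> H p" by (auto simp: H_def)
  qed (use openH connH that in \<open>auto simp: G open_halfspace_Re_gt\<close>)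
  define level where "level = (\<lambda>s. nat \<lceil>2 - Re s\<rceil>)"
  have level: "s \<in> H (level s)" for s
    unfolding H_def level_def using real_nat_ceiling_ge[of "2 - Re s"] by simp
  define F where "F = (\<lambda>s. G (level s) s)"
  have F_eq: "F s = G q s" if "s \<in> H q" for s q
    unfolding F_def using agree that level by (metis nat_le_linear)
  have hol: "F holomorphic_on UNIV"
  proof -
    have "F holomorphic_on (\<Union>q. H q)"
    proof (rule holomorphic_on_UN_open)
      show "F holomorphic_on H q" for q
        by (rule holomorphic_transform[OF G(1)]) (simp add: F_eq)
    qed (rule openH)
    moreover have "(\<Union>q. H q) = UNIV" using level by auto
    ultimately show ?thesis by simp
  qed
  have "is_zeta_continuation (\<lambda>s. F s / (s - 1))"
    unfolding is_zeta_continuation_def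
  proof (intro conjI allI impI)
    show "(\<lambda>s. F s / (s - 1)) holomorphic_on - {1}"
      by (intro holomorphic_intros holomorphic_on_subset[OF hol]) auto
    fix s :: complex assume s: "Re s > 1"
    have "F s / (s - 1) = zeta_series s"
      using s by (subst F_eq[of _ 0]) (auto simp: H_def G)
    thus "(\<lambda>n. 1 / of_nat (Suc n) powr s) sums (F s / (s - 1))"
      using sums_zeta_series[OF s] by (simp add: powr_minus_divide del: of_nat_Suc)
  qed
  thus ?thesis by blast
qed

lemma is_zeta_continuation_zeta: "is_zeta_continuation zeta"
proof -
  obtain f where f: "is_zeta_continuation f" using is_zeta_continuation_exists by blast
  define g where "g = f(1 := 0)"
  have g: "is_zeta_continuation g"
    unfolding is_zeta_continuation_def
  proof (intro conjI allI impI)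
    show "g holomorphic_on - {1}"
      by (rule holomorphic_transform[of f])
         (use f in \<open>auto simp: g_def is_zeta_continuation_def\<close>)
    fix s :: complex assume "Re s > 1"
    moreover from this have "s \<noteq> 1" by auto
    ultimately show "(\<lambda>n. 1 / of_nat (Suc n) powr s) sums g s"
      using f by (simp add: g_def is_zeta_continuation_def)
  qed
  have "zeta = g"
    unfolding zeta_def
  proof (rule the_equality)
    show "is_zeta_continuation g \<and> g 1 = 0" using g by (simp add: g_def)
    fix h assume h: "is_zeta_continuation h \<and> h 1 = 0"
    show "h = g"
    proof
      fix s show "h s = g s"
        using is_zeta_continuation_unique[of h g s] h g by (cases "s = 1") (auto simp: g_def)
    qed
  qed
  with g show ?thesis by simp
qed

end

theory Submission
  imports Defs "HOL-Real_Asymp.Real_Asymp"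
begin

text \<open>
  By Jensen's inequality it suffices to bound the mean of \<open>ln \<bar>zeta (\<sigma> + it)\<bar>\<close> over
  \<open>\<bar>t - T\<bar> \<le> \<delta>\<close> from below by \<open>- C * ln T * ln (e / \<delta>)\<close>. On the disc of radius \<open>19 / 10\<close> around
  \<open>2 + iT\<close> the function \<open>zeta\<close> is \<open>O(T)\<close>, and at the centre it is bounded away from \<open>0\<close>. Splitting off
  the Blaschke factors of its zeros leaves a zero-free bounded function, which Harnack's inequality
  bounds below by a power of \<open>T\<close>; there are \<open>O(ln T)\<close> such factors, and a zero with ordinate \<open>\<gamma>\<close>
  contributes at least the mean of \<open>ln \<bar>t - \<gamma>\<bar>\<close>, up to a constant. This mean is least for \<open>\<gamma> = T\<close>,
  where it equals \<open>- ln (e / \<delta>)\<close>.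
\<close>

subsection \<open>Bounded functions on the unit disc\<close>

text \<open>A Moebius automorphism moves the zero \<open>a\<close> to the origin, where the Schwarz
  lemma splits off a factor \<open>w\<close> with quotient bounded by 1; moving back turns
  \<open>w\<close> into the Blaschke factor of \<open>a\<close>.\<close>

lemma Blaschke_division:
  assumes holf: "f holomorphic_on ball 0 1" and bound: "\<And>z. norm z < 1 \<Longrightarrow> norm (f z) \<le> 1"
    and a: "norm a < 1" "f a = 0"
  obtains g where "g holomorphic_on ball 0 1" "\<And>z. norm z < 1 \<Longrightarrow> norm (g z) \<le> 1"
    "\<And>z. norm z < 1 \<Longrightarrow> f z = Moebius_function 0 a z * g z"
proof -
  define F where "F = (\<lambda>w. f (Moebius_function 0 (- a) w))"
  have holF: "F holomorphic_on ball 0 1"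
    unfolding F_def
    by (rule holomorphic_on_compose_gen[OF Moebius_function_holomorphic holf, unfolded o_def])
       (use a in \<open>auto intro!: Moebius_function_norm_lt_1\<close>)
  have F0: "F 0 = 0"
    by (simp add: F_def Moebius_function_of_zero a)
  have F_le: "norm (F w) \<le> 1" if "norm w < 1" for w
    unfolding F_def using that a by (intro bound Moebius_function_norm_lt_1) auto
  obtain h where h: "h holomorphic_on ball 0 1" "\<And>w. norm w < 1 \<Longrightarrow> F w = w * h w" "deriv F 0 = h 0"
    using Schwarz3[OF holF F0] by blast
  \<comment> \<open>The Schwarz lemma asks for a strict bound, so it is applied to
    \<open>c * F\<close> with \<open>0 < c < 1\<close>, and \<open>c\<close> is arbitrary. At
    \<open>w = 0\<close> its derivative part replaces the division by \<open>norm w\<close>.\<close>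
  have h_le: "norm (h w) \<le> 1" if w: "norm w < 1" for w
  proof (rule field_le_mult_one_interval)
    fix c :: real assume c: "0 < c" "c < 1"
    have hol: "(\<lambda>z. of_real c * F z) holomorphic_on ball 0 1"
      by (intro holomorphic_intros holF)
    have lt: "norm (of_real c * F z) < 1" if "norm z < 1" for z
    proof -
      have "c * norm (F z) \<le> c * 1" using F_le[OF that] c by (intro mult_left_mono) auto
      also have "\<dots> < 1" using c by simp
      finally show ?thesis using c by (simp add: norm_mult)
    qed
    note S = Schwarz_Lemma[OF hol _ lt]
    show "c * norm (h w) \<le> 1"
    proof (cases "w = 0")
      case True
      have "F field_differentiable at 0"
        using holF by (rule holomorphic_on_imp_differentiable_at) auto
      hence "deriv (\<lambda>z. of_real c * F z) 0 = of_real c * h 0"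
        by (simp add: h(3) deriv_cmult)
      thus ?thesis using S(2)[OF _ _ w] True F0 c by (simp add: norm_mult)
    next
      case False
      have "c * (norm w * norm (h w)) \<le> norm w"
        using S(1)[OF _ _ w] F0 c h(2)[OF w] by (simp add: norm_mult)
      hence "norm w * (c * norm (h w)) \<le> norm w * 1" by (simp add: mult_ac)
      thus ?thesis using False by (subst (asm) mult_le_cancel_left_pos) auto
    qed
  qed
  show thesis
  proof (rule that[of "\<lambda>z. h (Moebius_function 0 a z)"])
    show "(\<lambda>z. h (Moebius_function 0 a z)) holomorphic_on ball 0 1"
      by (rule holomorphic_on_compose_gen[OF Moebius_function_holomorphic h(1), unfolded o_def])
         (use a in \<open>auto intro!: Moebius_function_norm_lt_1\<close>)
    fix z :: complex assume z: "norm z < 1"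
    have M: "norm (Moebius_function 0 a z) < 1"
      using a z by (intro Moebius_function_norm_lt_1)
    show "norm (h (Moebius_function 0 a z)) \<le> 1" using h_le[OF M] .
    have "F (Moebius_function 0 a z) = f z"
      unfolding F_def using a z by (subst Moebius_function_compose) auto
    thus "f z = Moebius_function 0 a z * h (Moebius_function 0 a z)"
      using h(2)[OF M] by simp
  qed
qed

text \<open>
  Each division by a Blaschke factor with zero in the disc of radius \<open>r\<close> increases the modulus
  at the origin by a factor of at least \<open>1 / r\<close> but never beyond \<open>1\<close>, so the process stops.
\<close>

lemma Blaschke_factorization:
  assumes "f holomorphic_on ball 0 1" "\<And>z. norm z < 1 \<Longrightarrow> norm (f z) \<le> 1"
    and "f 0 \<noteq> 0" and r: "0 < r" "r < 1"
  shows "\<exists>as g. g holomorphic_on ball 0 1 \<and> (\<forall>z. norm z < 1 \<longrightarrow> norm (g z) \<le> 1) \<and>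
           (\<forall>z. norm z \<le> r \<longrightarrow> g z \<noteq> 0) \<and> (\<forall>a\<in>set as. norm a \<le> r) \<and>
           (\<forall>z. norm z < 1 \<longrightarrow> f z = (\<Prod>a\<leftarrow>as. Moebius_function 0 a z) * g z)"
proof -
  have "\<exists>n. r ^ n < norm (f 0)"
    using assms by (intro real_arch_pow_inv) auto
  then obtain n where "r ^ n < norm (f 0)" ..
  with assms(1,2) show ?thesis
  proof (induction n arbitrary: f)
    case 0
    from 0(2)[of 0] 0(3) show ?case by simp
  next
    case (Suc n)
    show ?case
    proof (cases "\<forall>z. norm z \<le> r \<longrightarrow> f z \<noteq> 0")
      case True
      thus ?thesis using Suc.prems by (intro exI[of _ "[]"] exI[of _ f]) auto
    next
      case False
      then obtain a where a: "norm a \<le> r" "f a = 0" by blast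
      obtain h where h: "h holomorphic_on ball 0 1" "\<And>z. norm z < 1 \<Longrightarrow> norm (h z) \<le> 1"
        "\<And>z. norm z < 1 \<Longrightarrow> f z = Moebius_function 0 a z * h z"
        using Blaschke_division[OF Suc.prems(1,2), of a] a r by auto
      have "norm (f 0) = norm a * norm (h 0)"
        using h(3)[of 0] by (simp add: Moebius_function_of_zero norm_mult)
      also have "\<dots> \<le> r * norm (h 0)" using a by (intro mult_right_mono) auto
      finally have "r * r ^ n < r * norm (h 0)" using Suc.prems(3) by simp
      hence "r ^ n < norm (h 0)" using r by simp
      from Suc.IH[OF h(1,2) this] obtain as g where
        "g holomorphic_on ball 0 1" "\<forall>z. norm z < 1 \<longrightarrow> norm (g z) \<le> 1"
        "\<forall>z. norm z \<le> r \<longrightarrow> g z \<noteq> 0" "\<forall>a\<in>set as. norm a \<le> r"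
        "\<forall>z. norm z < 1 \<longrightarrow> h z = (\<Prod>a\<leftarrow>as. Moebius_function 0 a z) * g z" by blast
      thus ?thesis using a h(3) by (intro exI[of _ "a # as"] exI[of _ g]) auto
    qed
  qed
qed

text \<open>The Schwarz lemma applied to the Cayley transform of \<open>h\<close> that vanishes at the origin.\<close>

lemma Harnack_upper:
  assumes holh: "h holomorphic_on ball 0 1" and pos: "\<And>z. norm z < 1 \<Longrightarrow> Re (h z) > 0"
    and z: "norm z \<le> \<rho>" "\<rho> < 1"
  shows "(1 - \<rho>) * Re (h z) \<le> (1 + \<rho>) * Re (h 0)"
proof -
  define q where "q = (\<lambda>z. (h z - h 0) / (h z + cnj (h 0)))"
  have pos0: "Re (h 0) > 0" using pos[of 0] by simp
  have nz: "h w + cnj (h 0) \<noteq> 0" if "norm w < 1" for w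
    using pos[OF that] pos0 by (auto simp: complex_eq_iff)
  have "q holomorphic_on ball 0 1"
    unfolding q_def using nz by (intro holomorphic_intros holh) auto
  moreover have "q 0 = 0" by (simp add: q_def)
  moreover have "norm (q w) < 1" if w: "norm w < 1" for w
  proof -
    \<comment> \<open>This identity shows that \<open>q\<close> maps into the unit disc exactly
      because \<open>h\<close> has positive real part.\<close>
    have "(norm (h w + cnj (h 0)))\<^sup>2 - (norm (h w - h 0))\<^sup>2 = 4 * (Re (h w) * Re (h 0))"
      unfolding cmod_power2 by (simp add: power2_eq_square algebra_simps)
    moreover have "Re (h w) * Re (h 0) > 0" using pos[OF w] pos0 by simp
    ultimately have "(norm (h w - h 0))\<^sup>2 < (norm (h w + cnj (h 0)))\<^sup>2" by linarith
    hence "norm (h w - h 0) < norm (h w + cnj (h 0))" by (rule power2_less_imp_less) simp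
    thus ?thesis using nz[OF w] by (simp add: q_def norm_divide)
  qed
  ultimately have "norm (q z) \<le> norm z" using z by (intro Schwarz_Lemma(1)) auto
  hence "norm (q z) \<le> \<rho>" using z by simp
  hence le: "norm (h z - h 0) \<le> \<rho> * norm (h z + cnj (h 0))"
    using nz[of z] z by (simp add: q_def norm_divide divide_simps)
  \<comment> \<open>The numerator and denominator of \<open>q z\<close> have the same imaginary part
    \<open>d\<close>. After squaring, \<rho> < 1 lets its contribution be dropped, which leaves an
    inequality between real parts.\<close>
  define x y where "x = Re (h z) - Re (h 0)" and "y = Re (h z) + Re (h 0)"
  define d where "d = Im (h z) - Im (h 0)"
  have \<rho>: "0 \<le> \<rho>" using z norm_ge_zero[of z] by linarith
  have "(norm (h z - h 0))\<^sup>2 \<le> (\<rho> * norm (h z + cnj (h 0)))\<^sup>2"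
    using le by (rule power_mono) simp
  hence "x\<^sup>2 + d\<^sup>2 \<le> \<rho>\<^sup>2 * (y\<^sup>2 + d\<^sup>2)"
    by (simp add: cmod_power2 power_mult_distrib x_def y_def d_def)
  moreover have "\<rho>\<^sup>2 * d\<^sup>2 \<le> 1 * d\<^sup>2"
    using \<rho> z by (intro mult_right_mono) (auto simp: power_le_one)
  ultimately have "x\<^sup>2 \<le> (\<rho> * y)\<^sup>2" by (simp add: power_mult_distrib algebra_simps)
  moreover have "0 \<le> \<rho> * y"
    unfolding y_def using \<rho> pos[of z] pos0 z by (intro mult_nonneg_nonneg) linarith+
  ultimately have "x \<le> \<rho> * y" by (rule power2_le_imp_le)
  thus ?thesis by (simp add: x_def y_def algebra_simps)
qed

text \<open>A zero-free \<open>g\<close> has a holomorphic logarithm whose real part is at most 0,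
  so Harnack's inequality, rescaled to radius \<open>r\<close>, carries the lower bound from the
  centre to \<open>z\<close>.\<close>

lemma nonvanishing_lower_bound:
  assumes holg: "g holomorphic_on ball 0 r" and r: "r > 0"
    and bound: "\<And>z. norm z < r \<Longrightarrow> norm (g z) \<le> 1"
    and nz: "\<And>z. norm z < r \<Longrightarrow> g z \<noteq> 0" and L: "exp (- L) \<le> norm (g 0)" "1 \<le> L"
    and z: "norm z \<le> \<kappa> * r" "\<kappa> < 1"
  shows "exp (- (2 * (1 + \<kappa>) / (1 - \<kappa>) * L)) \<le> norm (g z)"
proof -
  obtain l where l: "l holomorphic_on ball 0 r" "\<And>x. x \<in> ball 0 r \<Longrightarrow> exp (l x) = g x"
    using holomorphic_logarithm_exists[of "ball 0 r" g 0] holg nz r by auto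
  have norm_g: "norm (g x) = exp (Re (l x))" if "norm x < r" for x
    using l(2)[of x] that by (auto simp flip: norm_exp_eq_Re)
  \<comment> \<open>The summand 1 makes the real part strictly positive. It is absorbed by
    \<open>1 \<le> L\<close>, at the price of the factor 2 in the exponent.\<close>
  define h where "h = (\<lambda>x. 1 - l (of_real r * x))"
  have small: "norm (of_real r * x) < r" if "norm x < 1" for x :: complex
    using that r by (simp add: norm_mult)
  have "h holomorphic_on ball 0 1"
    unfolding h_def
    by (intro holomorphic_intros holomorphic_on_compose_gen[OF _ l(1), unfolded o_def])
       (use small in auto)
  moreover have "Re (h x) > 0" if "norm x < 1" for x
    using bound[OF small[OF that]] norm_g[OF small[OF that]] by (simp add: h_def)
  ultimately have "(1 - \<kappa>) * Re (h (z / of_real r)) \<le> (1 + \<kappa>) * Re (h 0)"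
    using z r by (intro Harnack_upper) (auto simp: norm_divide divide_simps)
  moreover have "Re (h (z / of_real r)) = 1 - Re (l z)" "Re (h 0) = 1 - Re (l 0)"
    using r by (simp_all add: h_def)
  moreover have "1 - Re (l 0) \<le> 2 * L"
    using L norm_g[of 0] r by simp
  moreover have \<kappa>: "0 \<le> \<kappa>"
    using order_trans[OF norm_ge_zero z(1)] r by (simp add: zero_le_mult_iff)
  ultimately have "(1 - \<kappa>) * (1 - Re (l z)) \<le> (1 + \<kappa>) * (2 * L)"
    by (metis (no_types) add_nonneg_nonneg mult_left_mono order_trans zero_le_one)
  hence "1 - Re (l z) \<le> (1 + \<kappa>) * (2 * L) / (1 - \<kappa>)"
    using z by (simp add: field_simps)
  hence "- (2 * (1 + \<kappa>) / (1 - \<kappa>) * L) \<le> Re (l z)" by (simp add: mult_ac)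
  moreover have "norm z < r"
    using z r by (smt (verit) mult_less_cancel_right2)
  ultimately show ?thesis using norm_g[of z] by simp
qed

lemma norm_prod_list: "norm (\<Prod>x\<leftarrow>xs. f x :: complex) = (\<Prod>x\<leftarrow>xs. norm (f x))"
  by (induction xs) (simp_all add: norm_mult)

lemma prod_list_nonneg: "(\<And>x. x \<in> set xs \<Longrightarrow> 0 \<le> f x) \<Longrightarrow> 0 \<le> (\<Prod>x\<leftarrow>xs. f x :: real)"
  by (induction xs) simp_all

text \<open>A factor 2 lost in each term is paid for by \<open>exp (- 1) \<le> 1 / 2\<close>; the
  exponential form merges with the other losses.\<close>

lemma prod_list_half_le:
  fixes u v :: "'a \<Rightarrow> real"
  assumes "\<And>x. x \<in> set xs \<Longrightarrow> 0 \<le> u x" "\<And>x. x \<in> set xs \<Longrightarrow> u x / 2 \<le> v x"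
  shows "exp (- real (length xs)) * (\<Prod>x\<leftarrow>xs. u x) \<le> (\<Prod>x\<leftarrow>xs. v x)"
  using assms
proof (induction xs)
  case (Cons x xs)
  have "exp (- 1) \<le> (1 / 2 :: real)"
    using exp_ge_add_one_self[of 1] by (simp add: exp_minus field_simps)
  hence "exp (- 1) * u x \<le> 1 / 2 * u x" using Cons.prems(1)[of x] by (intro mult_right_mono) auto
  hence "exp (- 1) * u x \<le> v x" using Cons.prems(2)[of x] by simp
  moreover have "0 \<le> (\<Prod>x\<leftarrow>xs. u x)" using Cons.prems by (intro prod_list_nonneg) auto
  moreover have "0 \<le> exp (- 1) * u x" using Cons.prems(1)[of x] by simp
  moreover from calculation have "0 \<le> v x" by linarith
  ultimately have "(exp (- 1) * u x) * (exp (- real (length xs)) * (\<Prod>x\<leftarrow>xs. u x)) \<le>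
      v x * (\<Prod>x\<leftarrow>xs. v x)"
    using Cons by (intro mult_mono) auto
  thus ?case by (simp add: exp_add[symmetric] exp_diff exp_minus field_simps)
qed simp

text \<open>After the Blaschke factorization, the value at the origin limits the number of factors,
  Harnack's inequality bounds the zero-free part, and each Blaschke factor is at least half the
  distance to its zero. The constant depends on \<rho> alone.\<close>

lemma lower_bound_by_zeros:
  assumes \<rho>: "0 \<le> \<rho>" "\<rho> < 1"
  shows "\<exists>C>0. \<forall>f L. f holomorphic_on ball 0 1 \<longrightarrow> (\<forall>z. norm z < 1 \<longrightarrow> norm (f z) \<le> 1) \<longrightarrow>
           exp (- L) \<le> norm (f 0) \<longrightarrow> 1 \<le> L \<longrightarrow>
           (\<exists>as. real (length as) \<le> C * L \<and>
             (\<forall>z. norm z \<le> \<rho> \<longrightarrow> exp (- (C * L)) * (\<Prod>a\<leftarrow>as. norm (z - a)) \<le> norm (f z)))"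
proof -
  \<comment> \<open>Zeros are removed up to a radius strictly between \<rho> and 1:
    \<open>r < 1\<close> makes them countable from the value at 0, and \<rho> < \<open>r\<close>
    leaves room for Harnack's inequality.\<close>
  define r \<kappa> where "r = (1 + \<rho>) / 2" and "\<kappa> = \<rho> / r"
  have r: "0 < r" "r < 1" "\<rho> < r" using \<rho> by (auto simp: r_def)
  have \<kappa>: "0 \<le> \<kappa>" "\<kappa> < 1" "\<rho> = \<kappa> * r" using r \<rho> by (auto simp: \<kappa>_def)
  define K where "K = 2 * (1 + \<kappa>) / (1 - \<kappa>)"
  define N where "N = 1 / ln (1 / r)"
  have K: "K > 0" using \<kappa> by (simp add: K_def)
  have lnr: "ln (1 / r) > 0" using r by (subst ln_gt_zero_iff) auto
  hence N: "N > 0" by (simp add: N_def)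
  show ?thesis
  proof (intro exI[of _ "K + N"] conjI allI impI)
    show "K + N > 0" using K N by simp
    fix f :: "complex \<Rightarrow> complex" and L :: real
    assume f: "f holomorphic_on ball 0 1" "\<forall>z. norm z < 1 \<longrightarrow> norm (f z) \<le> 1"
      and L: "exp (- L) \<le> norm (f 0)" "1 \<le> L"
    have f0: "f 0 \<noteq> 0" using L(1) by auto
    obtain as g where g: "g holomorphic_on ball 0 1" "\<And>z. norm z < 1 \<Longrightarrow> norm (g z) \<le> 1"
      "\<And>z. norm z \<le> r \<Longrightarrow> g z \<noteq> 0" "\<And>a. a \<in> set as \<Longrightarrow> norm a \<le> r"
      "\<And>z. norm z < 1 \<Longrightarrow> f z = (\<Prod>a\<leftarrow>as. Moebius_function 0 a z) * g z"
      using Blaschke_factorization[OF f(1) _ f0 r(1,2)] f(2) by metis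
    have prod_le: "(\<Prod>a\<leftarrow>as. norm a) \<le> r ^ length as"
      using g(4)
    proof (induction as)
      case (Cons a as)
      have "norm a * (\<Prod>a\<leftarrow>as. norm a) \<le> r * r ^ length as"
        using Cons r by (intro mult_mono prod_list_nonneg) auto
      thus ?case by simp
    qed simp
    have f0_eq: "norm (f 0) = (\<Prod>a\<leftarrow>as. norm a) * norm (g 0)"
      using g(5)[of 0] by (simp add: norm_mult norm_prod_list Moebius_function_of_zero)
    have prod0: "0 \<le> (\<Prod>a\<leftarrow>as. norm a)" by (intro prod_list_nonneg) auto
    \<comment> \<open>Jensen's zero count: \<open>n\<close> zeros in the disc of radius
      \<open>r\<close> force \<open>exp (- L) \<le> r ^ n\<close>.\<close>
    have "norm (f 0) \<le> r ^ length as * 1"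
      unfolding f0_eq using prod_le prod0 g(2)[of 0] r by (intro mult_mono) auto
    hence "exp (- L) \<le> r ^ length as" using L by simp
    hence "- L \<le> ln (r ^ length as)" using r by (subst ln_ge_iff) auto
    hence "real (length as) * ln (1 / r) \<le> L" using r by (simp add: ln_realpow ln_div)
    hence len: "real (length as) \<le> N * L" using lnr by (simp add: N_def field_simps)
    have "norm (f 0) \<le> 1 * norm (g 0)"
      unfolding f0_eq using prod_le power_le_one[of r "length as"] r
      by (intro mult_right_mono) auto
    hence g0: "exp (- L) \<le> norm (g 0)" using L by simp
    show "\<exists>as. real (length as) \<le> (K + N) * L \<and>
            (\<forall>z. norm z \<le> \<rho> \<longrightarrow> exp (- ((K + N) * L)) * (\<Prod>a\<leftarrow>as. norm (z - a)) \<le> norm (f z))"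
    proof (intro exI[of _ as] conjI allI impI)
      show "real (length as) \<le> (K + N) * L"
        using len K L by (simp add: distrib_right add_increasing)
      fix z :: complex assume z: "norm z \<le> \<rho>"
      have z1: "norm z < 1" using z \<rho> by simp
      have "exp (- (K * L)) \<le> norm (g z)"
        unfolding K_def
      proof (rule nonvanishing_lower_bound[where r = r and g = g and z = z])
        show "g holomorphic_on ball 0 r" using g(1) r by (auto intro: holomorphic_on_subset)
      qed (use g r \<kappa> L g0 z in auto)
      moreover have "exp (- real (length as)) * (\<Prod>a\<leftarrow>as. norm (z - a)) \<le>
          (\<Prod>a\<leftarrow>as. norm (Moebius_function 0 a z))"
      proof (rule prod_list_half_le)
        fix a assume "a \<in> set as"
        hence a: "norm a < 1" using g(4)[of a] r by simp
        have "norm (1 - cnj a * z) \<le> 1 + norm a * norm z"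
          by (rule norm_triangle_le_diff) (simp add: norm_mult)
        moreover have "norm a * norm z \<le> 1 * 1" using a z1 by (intro mult_mono) auto
        ultimately have "norm (1 - cnj a * z) \<le> 2" by simp
        moreover have "norm (1 - cnj a * z) > 0"
        proof -
          have "norm (cnj a * z) < 1" using a z1 norm_mult_less[of "cnj a" 1 z 1] by simp
          thus ?thesis by auto
        qed
        ultimately have "norm (z - a) / 2 \<le> norm (z - a) / norm (1 - cnj a * z)"
          by (intro divide_left_mono mult_pos_pos) auto
        thus "norm (z - a) / 2 \<le> norm (Moebius_function 0 a z)"
          by (simp only: Moebius_function_simple norm_divide)
      qed auto
      moreover have "exp (- (N * L)) * (\<Prod>a\<leftarrow>as. norm (z - a)) \<le>
          exp (- real (length as)) * (\<Prod>a\<leftarrow>as. norm (z - a))"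
        using len by (intro mult_right_mono prod_list_nonneg) auto
      ultimately have "(exp (- (N * L)) * (\<Prod>a\<leftarrow>as. norm (z - a))) * exp (- (K * L)) \<le>
          (\<Prod>a\<leftarrow>as. norm (Moebius_function 0 a z)) * norm (g z)"
        by (intro mult_mono prod_list_nonneg) auto
      also have "\<dots> = norm (f z)" using g(5)[OF z1] by (simp add: norm_mult norm_prod_list)
      finally show "exp (- ((K + N) * L)) * (\<Prod>a\<leftarrow>as. norm (z - a)) \<le> norm (f z)"
        by (simp add: distrib_right exp_add[symmetric] exp_diff exp_minus field_simps)
    qed
  qed
qed

subsection \<open>Bounds for the zeta-function\<close>

lemma zeta_eq_zeta_series: "Re s > 1 \<Longrightarrow> zeta s = zeta_series s"
  using is_zeta_continuation_zeta unfolding is_zeta_continuation_def zeta_series_def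
  by (simp add: sums_iff)

lemma holomorphic_zeta: "zeta holomorphic_on - {1}"
  using is_zeta_continuation_zeta unfolding is_zeta_continuation_def by simp

text \<open>For \<open>Re s > 1\<close> this is the telescoped recurrence with \<open>m = 1\<close>;
  analytic continuation extends it to the half-plane where the remainder series is
  holomorphic.\<close>

lemma zeta_halfplane:
  assumes "Re s > 0" "s \<noteq> 1"
  shows "(s - 1) * zeta s = 1 + (\<Sum>n. taylor_error 1 n s)"
proof (rule analytic_continuation_open[where s = "{s. Re s > 1}" and s' = "{s. Re s > 0} - {1}"
      and f = "\<lambda>s. (s - 1) * zeta s" and g = "\<lambda>s. 1 + (\<Sum>n. taylor_error 1 n s)"])
  show "connected ({s. Re s > 0} - {1})"
    by (rule connected_open_delete)
       (auto intro: open_halfspace_Re_gt convex_connected convex_halfspace_Re_gt)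
  show "open ({s. Re s > 0} - {1})" by (intro open_delete open_halfspace_Re_gt)
  show "open {s. Re s > 1}" by (rule open_halfspace_Re_gt)
  show "{s. Re s > 1} \<noteq> {}" by (auto intro: exI[of _ 2])
  show "{s. Re s > 1} \<subseteq> {s. Re s > 0} - {1}" by auto
  show "(\<lambda>s. (s - 1) * zeta s) holomorphic_on {s. Re s > 0} - {1}"
    by (intro holomorphic_intros holomorphic_on_subset[OF holomorphic_zeta]) auto
  show "(\<lambda>s. 1 + (\<Sum>n. taylor_error 1 n s)) holomorphic_on {s. Re s > 0} - {1}"
    by (intro holomorphic_intros holomorphic_on_subset[OF holomorphic_suminf_taylor_error]) auto
  show "(z - 1) * zeta z = 1 + (\<Sum>n. taylor_error 1 n z)" if "z \<in> {s. Re s > 1}" for z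
    using that by (simp add: zeta_series_recurrence zeta_eq_zeta_series falling_def)
qed (use assms in auto)

text \<open>The second-order remainder is \<open>O(norm (s - 1) * norm s)\<close>, and dividing by
  \<open>s - 1\<close> leaves linear growth. The abscissa \<open>1 / 10\<close> is the left edge of
  the disc of radius \<open>19 / 10\<close> around \<open>2 + iT\<close>, and gives the summable
  exponent \<open>11 / 10\<close>.\<close>

lemma zeta_linear_bound:
  "\<exists>K>0. \<forall>s. Re s \<ge> 1 / 10 \<longrightarrow> \<bar>Im s\<bar> \<ge> 1 \<longrightarrow> norm (zeta s) \<le> 1 + K * norm s"
proof -
  define K where "K = (\<Sum>n. real (Suc n) powr (- (11 / 10)))"
  have sm: "summable (\<lambda>n. real (Suc n) powr (- (11 / 10)))" by (rule summable_Suc_powr) simp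
  have "K > 0" unfolding K_def using sm by (rule suminf_pos) simp
  moreover have "norm (zeta s) \<le> 1 + K * norm s" if s: "Re s \<ge> 1 / 10" "\<bar>Im s\<bar> \<ge> 1" for s
  proof -
    have s1: "norm (s - 1) \<ge> 1" using abs_Im_le_cmod[of "s - 1"] s by simp
    have "norm (\<Sum>n. taylor_error 1 n s) \<le>
        (\<Sum>n. norm (s - 1) * norm s * real (Suc n) powr (- (11 / 10)))"
    proof (rule norm_suminf_le)
      fix n
      have "norm (taylor_error 1 n s) \<le>
          norm (falling (Suc 1) s) * real (Suc n) powr (- (11 / 10)) / fact 1"
        using s by (intro norm_taylor_error_le) auto
      also have "norm (falling (Suc 1) s) = norm (s - 1) * norm s"
        by (simp add: falling_def norm_mult norm_minus_commute)
      finally show "norm (taylor_error 1 n s) \<le>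
          norm (s - 1) * norm s * real (Suc n) powr (- (11 / 10))" by simp
    qed (intro summable_mult sm)
    also have "\<dots> = norm (s - 1) * norm s * K" unfolding K_def using sm by (rule suminf_mult)
    finally have "norm ((s - 1) * zeta s) \<le> 1 + norm (s - 1) * norm s * K"
      using s s1 by (subst zeta_halfplane) (auto intro!: norm_triangle_le)
    also have "\<dots> \<le> norm (s - 1) * (1 + K * norm s)" using s1 by (simp add: algebra_simps)
    finally show ?thesis
      unfolding norm_mult using s1 by (subst (asm) mult_le_cancel_left_pos) auto
  qed
  ultimately show ?thesis by blast
qed

text \<open>On this line the terms after the first add up to at most
  \<open>pi\<^sup>2 / 6 - 1\<close>, which is below \<open>3 / 4\<close>.\<close>

lemma norm_zeta_2_ge: "norm (zeta (Complex 2 T)) \<ge> 1 / 4"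
proof -
  define s where "s = Complex 2 T"
  have "(\<lambda>n. of_nat (Suc n) powr (- s)) sums zeta s"
    using sums_zeta_series[of s] by (simp add: zeta_eq_zeta_series s_def)
  hence *: "(\<lambda>n. of_nat (Suc (Suc n)) powr (- s)) sums (zeta s - 1)"
    by (subst sums_Suc_iff) simp
  have "(\<lambda>n. 1 / (real n + 1)\<^sup>2) sums (pi\<^sup>2 / 6)" using inverse_squares_sums by (simp add: add.commute)
  hence B: "(\<lambda>n. 1 / (real (Suc n) + 1)\<^sup>2) sums (pi\<^sup>2 / 6 - 1)"
    by (subst sums_Suc_iff[where f = "\<lambda>n. 1 / (real n + 1)\<^sup>2"]) simp
  have "norm (zeta s - 1) \<le> pi\<^sup>2 / 6 - 1"
    unfolding sums_unique[OF *] sums_unique[OF B]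
  proof (rule norm_suminf_le)
    show "summable (\<lambda>n. 1 / (real (Suc n) + 1)\<^sup>2)" using B by (rule sums_summable)
    fix n
    have "norm (of_nat (Suc (Suc n)) powr (- s)) = real (Suc (Suc n)) powr (- 2)"
      by (subst norm_Suc_powr) (simp add: s_def)
    also have "\<dots> = 1 / (real (Suc n) + 1)\<^sup>2"
      by (simp add: powr_minus_divide add_ac)
    finally show "norm (of_nat (Suc (Suc n)) powr (- s)) \<le> 1 / (real (Suc n) + 1)\<^sup>2" by simp
  qed
  moreover have "pi\<^sup>2 \<le> 3.2\<^sup>2" using pi_approx by (intro power_mono) auto
  ultimately have "norm (zeta s - 1) \<le> 3 / 4" by (simp add: power2_eq_square)
  moreover have "norm (1 :: complex) \<le> norm (zeta s) + norm (zeta s - 1)"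
    using norm_triangle_ineq4[of "zeta s" "zeta s - 1"] by simp
  ultimately show ?thesis by (simp add: s_def)
qed

text \<open>The disc of radius \<open>19 / 10\<close> around \<open>2 + iT\<close> is rescaled to
  the unit disc and zeta is divided by a bound \<open>K * T\<close>. Only the ordinates of the zeros
  are kept, so the list serves all \<sigma> and \<open>t\<close> at once.\<close>

lemma zeta_lower_bound_by_zeros:
  "\<exists>C>0. \<exists>T0\<ge>3. \<forall>T\<ge>T0. \<exists>gs. real (length gs) \<le> C * ln T \<and>
     (\<forall>\<sigma> t. 1 / 2 \<le> \<sigma> \<longrightarrow> \<sigma> \<le> 1 \<longrightarrow> \<bar>t - T\<bar> \<le> 1 / 2 \<longrightarrow>
        exp (- (C * ln T)) * (\<Prod>\<gamma>\<leftarrow>gs. \<bar>t - \<gamma>\<bar>) \<le> norm (zeta (Complex \<sigma> t)))"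
proof -
  obtain K0 where K0: "K0 > 0"
    "\<And>s. Re s \<ge> 1 / 10 \<Longrightarrow> \<bar>Im s\<bar> \<ge> 1 \<Longrightarrow> norm (zeta s) \<le> 1 + K0 * norm s"
    using zeta_linear_bound by blast
  define K where "K = 1 + 3 * K0"
  have K: "K \<ge> 1" using K0 by (simp add: K_def)
  \<comment> \<open>The points considered lie within \<open>sqrt (5 / 2) < 8 / 5\<close> of
    \<open>2 + iT\<close>, that is within \<open>16 / 19\<close> of the origin after
    rescaling.\<close>
  have "(0::real) \<le> 16 / 19" "(16 / 19 :: real) < 1" by simp_all
  from lower_bound_by_zeros[OF this] obtain C where C: "C > 0"
    "\<And>f L. f holomorphic_on ball 0 1 \<Longrightarrow> (\<forall>z. norm z < 1 \<longrightarrow> norm (f z) \<le> 1) \<Longrightarrow>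
           exp (- L) \<le> norm (f 0) \<Longrightarrow> 1 \<le> L \<Longrightarrow>
           (\<exists>as. real (length as) \<le> C * L \<and>
             (\<forall>z. norm z \<le> 16 / 19 \<longrightarrow> exp (- (C * L)) * (\<Prod>a\<leftarrow>as. norm (z - a)) \<le> norm (f z)))"
    by metis
  show ?thesis
  \<comment> \<open>\<open>T \<ge> 4 * K\<close> yields \<open>4 * K * T \<le> T * T\<close>, hence
    \<open>L \<le> 2 * ln T\<close>. The factor 4 leaves \<open>2 * C\<close> for the exponent
    \<open>C * L\<close> and \<open>2 * C\<close> for halving each distance.\<close>
  proof (rule exI[of _ "4 * C"], rule conjI[rotated], rule exI[of _ "4 * K"], intro conjI allI impI)
    show "4 * C > 0" "4 * K \<ge> 3" using C K by simp_all
    fix T assume T: "T \<ge> 4 * K"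
    have T4: "T \<ge> 4" using T K by simp
    define c where "c = Complex 2 T"
    define f where "f = (\<lambda>z. zeta (c + of_real (19 / 10) * z) / of_real (K * T))"
    have KT: "K * T \<ge> 1" using K T4 mult_mono[of 1 K 1 T] by simp
    have inside: "Re (c + of_real (19 / 10) * z) \<ge> 1 / 10 \<and> Im (c + of_real (19 / 10) * z) \<ge> 1"
      if "norm z < 1" for z
      using abs_Re_le_cmod[of z] abs_Im_le_cmod[of z] that T4 by (auto simp: c_def abs_le_iff)
    have holf: "f holomorphic_on ball 0 1"
      unfolding f_def
    proof (intro holomorphic_intros holomorphic_on_compose_gen[OF _ holomorphic_zeta, unfolded o_def])
      show "(\<lambda>z. c + of_real (19 / 10) * z) ` ball 0 1 \<subseteq> - {1}"
        using inside by fastforce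
    qed (use KT in \<open>auto intro!: holomorphic_intros\<close>)
    have f_le: "norm (f z) \<le> 1" if z: "norm z < 1" for z
    proof -
      have "norm (c + of_real (19 / 10) * z) \<le> norm c + 19 / 10 * norm z"
        by (rule norm_triangle_le) (simp add: norm_mult)
      moreover have "norm c \<le> 2 + T"
        using cmod_le[of c] T4 by (simp add: c_def)
      ultimately have "norm (c + of_real (19 / 10) * z) \<le> 3 * T" using z T4 by simp
      hence "K0 * norm (c + of_real (19 / 10) * z) \<le> K0 * (3 * T)"
        using K0 by (intro mult_left_mono) auto
      moreover have "norm (zeta (c + of_real (19 / 10) * z)) \<le>
          1 + K0 * norm (c + of_real (19 / 10) * z)"
        using inside[OF z] by (intro K0(2)) auto
      moreover have "1 + K0 * (3 * T) \<le> K * T" using T4 by (simp add: K_def algebra_simps)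
      ultimately have "norm (zeta (c + of_real (19 / 10) * z)) \<le> K * T" by linarith
      thus ?thesis unfolding f_def norm_divide norm_of_real using KT by (subst divide_le_eq_1_pos) auto
    qed
    define L where "L = ln (4 * K * T)"
    have "exp (- L) = 1 / 4 / (K * T)" using K T4 by (simp add: L_def exp_minus field_simps)
    also have "\<dots> \<le> norm (zeta c) / (K * T)"
      unfolding c_def using KT by (intro divide_right_mono norm_zeta_2_ge) auto
    also have "\<dots> = norm (f 0)" using KT by (simp add: f_def norm_divide del: of_real_mult)
    finally have f0: "exp (- L) \<le> norm (f 0)" .
    have "exp 1 \<le> 4 * K * T" using exp_le KT by simp
    hence L1: "1 \<le> L" unfolding L_def using K T4 by (subst ln_ge_iff) auto
    have "L \<le> ln (T * T)"
      unfolding L_def using T T4 K by (intro ln_mono mult_right_mono mult_pos_pos) auto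
    hence L2: "C * L \<le> 2 * C * ln T" using T4 C by (simp add: ln_mult)
    obtain as where as: "real (length as) \<le> C * L"
      "\<And>z. norm z \<le> 16 / 19 \<Longrightarrow> exp (- (C * L)) * (\<Prod>a\<leftarrow>as. norm (z - a)) \<le> norm (f z)"
      using C(2)[OF holf _ f0 L1] f_le by blast
    define gs where "gs = map (\<lambda>a. T + 19 / 10 * Im a) as"
    show "\<exists>gs. real (length gs) \<le> 4 * C * ln T \<and>
     (\<forall>\<sigma> t. 1 / 2 \<le> \<sigma> \<longrightarrow> \<sigma> \<le> 1 \<longrightarrow> \<bar>t - T\<bar> \<le> 1 / 2 \<longrightarrow>
        exp (- (4 * C * ln T)) * (\<Prod>\<gamma>\<leftarrow>gs. \<bar>t - \<gamma>\<bar>) \<le> norm (zeta (Complex \<sigma> t)))"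
    proof (intro exI[of _ gs] conjI allI impI)
      have "0 \<le> 2 * C * ln T" using C T4 by simp
      thus "real (length gs) \<le> 4 * C * ln T" using as(1) L2 by (simp add: gs_def)
      fix \<sigma> t :: real assume \<sigma>: "1 / 2 \<le> \<sigma>" "\<sigma> \<le> 1" and t: "\<bar>t - T\<bar> \<le> 1 / 2"
      define z where "z = Complex ((\<sigma> - 2) / (19 / 10)) ((t - T) / (19 / 10))"
      have z_eq: "c + of_real (19 / 10) * z = Complex \<sigma> t"
        by (simp add: c_def z_def complex_eq_iff field_simps)
      have "(2 - \<sigma>)\<^sup>2 \<le> (3 / 2)\<^sup>2" "\<bar>t - T\<bar>\<^sup>2 \<le> (1 / 2)\<^sup>2"
        using \<sigma> t by (intro power_mono; simp)+
      hence "(\<sigma> - 2)\<^sup>2 + (t - T)\<^sup>2 \<le> 5 / 2"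
        by (simp add: power2_eq_square algebra_simps)
      hence "((\<sigma> - 2)\<^sup>2 + (t - T)\<^sup>2) / (19 / 10)\<^sup>2 \<le> (5 / 2) / (19 / 10)\<^sup>2"
        by (rule divide_right_mono) simp
      also have "((\<sigma> - 2)\<^sup>2 + (t - T)\<^sup>2) / (19 / 10)\<^sup>2 = (norm z)\<^sup>2"
        unfolding cmod_power2 z_def complex.sel power_divide add_divide_distrib ..
      also have "(5 / 2) / (19 / 10)\<^sup>2 \<le> (16 / 19 :: real)\<^sup>2" by (simp add: power2_eq_square)
      finally have "(norm z)\<^sup>2 \<le> (16 / 19)\<^sup>2" .
      hence "norm z \<le> 16 / 19" by (rule power2_le_imp_le) simp
      note lb = as(2)[OF this]
      have "(\<Prod>\<gamma>\<leftarrow>gs. \<bar>t - \<gamma>\<bar>) = (\<Prod>a\<leftarrow>as. \<bar>t - (T + 19 / 10 * Im a)\<bar>)"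
        by (simp add: gs_def o_def)
      also have "exp (- real (length as)) * \<dots> \<le> (\<Prod>a\<leftarrow>as. norm (z - a))"
      proof (rule prod_list_half_le)
        fix a
        \<comment> \<open>Undoing the scaling divides ordinate differences by
          \<open>19 / 10\<close>, which is less than 2.\<close>
        have "\<bar>t - (T + 19 / 10 * Im a)\<bar> / 2 \<le> \<bar>Im (z - a)\<bar>"
          by (simp add: z_def abs_if field_simps)
        also have "\<dots> \<le> norm (z - a)" by (rule abs_Im_le_cmod)
        finally show "\<bar>t - (T + 19 / 10 * Im a)\<bar> / 2 \<le> norm (z - a)" .
      qed auto
      finally have 1: "exp (- real (length as)) * (\<Prod>\<gamma>\<leftarrow>gs. \<bar>t - \<gamma>\<bar>) \<le> (\<Prod>a\<leftarrow>as. norm (z - a))" .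
      have "exp (- (4 * C * ln T)) \<le> exp (- (C * L)) * exp (- real (length as))"
        using as(1) L2 by (simp flip: exp_add)
      hence "exp (- (4 * C * ln T)) * (\<Prod>\<gamma>\<leftarrow>gs. \<bar>t - \<gamma>\<bar>) \<le>
          exp (- (C * L)) * exp (- real (length as)) * (\<Prod>\<gamma>\<leftarrow>gs. \<bar>t - \<gamma>\<bar>)"
        by (intro mult_right_mono prod_list_nonneg) auto
      also have "\<dots> \<le> exp (- (C * L)) * (\<Prod>a\<leftarrow>as. norm (z - a))"
        unfolding mult.assoc by (intro mult_left_mono 1) auto
      also have "\<dots> \<le> norm (f z)" by (rule lb)
      also have "\<dots> = norm (zeta (Complex \<sigma> t)) / (K * T)"
        unfolding f_def z_eq norm_divide norm_of_real using KT by simp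
      also have "\<dots> \<le> norm (zeta (Complex \<sigma> t)) / 1"
        using KT by (intro divide_left_mono) auto
      finally show "exp (- (4 * C * ln T)) * (\<Prod>\<gamma>\<leftarrow>gs. \<bar>t - \<gamma>\<bar>) \<le> norm (zeta (Complex \<sigma> t))"
        by simp
    qed
  qed
qed

subsection \<open>Averages of powers over short intervals\<close>

text \<open>At 0 the convention \<open>ln 0 = 0\<close> agrees with the limit, so the antiderivative
  of the logarithm is continuous across its singularity.\<close>

lemma isCont_x_ln_abs: "isCont (\<lambda>x::real. x * ln \<bar>x\<bar>) x"
proof (cases "x = 0")
  case True
  have "((\<lambda>x::real. x * ln \<bar>x\<bar>) \<longlongrightarrow> 0) (at 0)"
    unfolding filterlim_at_split by (intro conjI; real_asymp)
  thus ?thesis using True by (simp add: isCont_def)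
next
  case False
  thus ?thesis by (intro continuous_intros) auto
qed

text \<open>The integrand has the junk value \<open>ln 0 = 0\<close> at \<open>\<gamma>\<close>, which does not affect the integral.\<close>

lemma has_integral_ln_abs:
  fixes a b \<gamma> :: real
  assumes "a \<le> b"
  shows "((\<lambda>t. ln \<bar>t - \<gamma>\<bar>) has_integral
           ((b - \<gamma>) * ln \<bar>b - \<gamma>\<bar> - (b - \<gamma>) - ((a - \<gamma>) * ln \<bar>a - \<gamma>\<bar> - (a - \<gamma>)))) {a..b}"
proof (rule fundamental_theorem_of_calculus_strong[where S = "{\<gamma>}"])
  have "continuous_on {a..b} (\<lambda>t. (t - \<gamma>) * ln \<bar>t - \<gamma>\<bar>)"
    by (rule continuous_on_compose2[OF continuous_at_imp_continuous_on[of UNIV "\<lambda>x. x * ln \<bar>x\<bar>"]])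
       (auto intro!: isCont_x_ln_abs continuous_intros)
  thus "continuous_on {a..b} (\<lambda>t. (t - \<gamma>) * ln \<bar>t - \<gamma>\<bar> - (t - \<gamma>))"
    by (rule continuous_on_diff) (intro continuous_intros)
  fix t assume "t \<in> {a..b} - {\<gamma>}"
  hence t: "t \<noteq> \<gamma>" by simp
  have "((\<lambda>t. (t - \<gamma>) * ln \<bar>t - \<gamma>\<bar> - (t - \<gamma>)) has_real_derivative ln \<bar>t - \<gamma>\<bar>) (at t)"
  proof (cases "t > \<gamma>")
    case True
    have "((\<lambda>t. (t - \<gamma>) * ln (t - \<gamma>) - (t - \<gamma>)) has_real_derivative ln \<bar>t - \<gamma>\<bar>) (at t)"
      using True by (auto intro!: derivative_eq_intros)
    moreover have "eventually (\<lambda>t. t > \<gamma>) (nhds t)"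
      using True by (intro eventually_nhds_in_open[of "{\<gamma><..}" t, simplified])
    hence "eventually (\<lambda>t. (t - \<gamma>) * ln \<bar>t - \<gamma>\<bar> - (t - \<gamma>) = (t - \<gamma>) * ln (t - \<gamma>) - (t - \<gamma>)) (nhds t)"
      by eventually_elim simp
    ultimately show ?thesis by (subst DERIV_cong_ev[OF refl _ refl])
  next
    case False
    have "((\<lambda>t. (t - \<gamma>) * ln (\<gamma> - t) - (t - \<gamma>)) has_real_derivative ln \<bar>t - \<gamma>\<bar>) (at t)"
      using False t by (auto intro!: derivative_eq_intros simp: divide_simps)
    moreover have "eventually (\<lambda>t. t < \<gamma>) (nhds t)"
      using False t by (intro eventually_nhds_in_open[of "{..<\<gamma>}" t, simplified]) auto
    hence "eventually (\<lambda>t. (t - \<gamma>) * ln \<bar>t - \<gamma>\<bar> - (t - \<gamma>) = (t - \<gamma>) * ln (\<gamma> - t) - (t - \<gamma>)) (nhds t)"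
      by eventually_elim simp
    ultimately show ?thesis by (subst DERIV_cong_ev[OF refl _ refl])
  qed
  thus "((\<lambda>t. (t - \<gamma>) * ln \<bar>t - \<gamma>\<bar> - (t - \<gamma>)) has_vector_derivative ln \<bar>t - \<gamma>\<bar>) (at t)"
    by (simp add: has_real_derivative_iff_has_vector_derivative)
qed (use assms in auto)

text \<open>Here \<open>p\<close> and \<open>q\<close> stand for the signed distances from \<gamma>
  to the two ends of an interval of length \<open>2 * \<delta>\<close>; the minimum occurs when
  \<gamma> is the midpoint.\<close>

lemma x_ln_x_midpoint:
  fixes p q :: real
  assumes "p + q = 2 * \<delta>" "\<delta> > 0"
  shows "2 * \<delta> * ln \<delta> \<le> p * ln \<bar>p\<bar> + q * ln \<bar>q\<bar>"
proof -
  have *: "2 * \<delta> * ln \<delta> \<le> p * ln \<bar>p\<bar> + q * ln \<bar>q\<bar>" if pq: "p + q = 2 * \<delta>" "p \<ge> q" for p q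
  proof (cases "q \<ge> 0")
    case True
    \<comment> \<open>With both distances nonnegative, the convex function \<open>x * ln x\<close>
      lies above its tangent at \<delta>.\<close>
    have tangent: "x * ln \<delta> + (x - \<delta>) \<le> x * ln \<bar>x\<bar>" if "x \<ge> 0" for x
    proof (cases "x = 0")
      case False
      have "x * ln (\<delta> / x) \<le> x * (\<delta> / x - 1)"
        using that False assms by (intro mult_left_mono ln_le_minus_one) auto
      thus ?thesis using that False assms by (simp add: ln_div algebra_simps)
    qed (use assms in auto)
    have "(p + q) * ln \<delta> + (p + q - 2 * \<delta>) \<le> p * ln \<bar>p\<bar> + q * ln \<bar>q\<bar>"
      using tangent[of p] tangent[of q] True pq unfolding distrib_right by linarith
    moreover have "(p + q) * ln \<delta> = 2 * \<delta> * ln \<delta>" using pq(1) by simp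
    ultimately show ?thesis using pq(1) by linarith
  next
    case False
    \<comment> \<open>If \<gamma> lies outside the interval, then \<open>- q < p\<close>, so
      replacing \<open>ln \<bar>q\<bar>\<close> by \<open>ln p\<close> only lowers the sum.\<close>
    have p: "p > 0" "p \<ge> \<delta>" using False pq assms by auto
    have "(- q) * ln (- q) \<le> (- q) * ln p"
      using False pq assms by (intro mult_left_mono ln_mono) auto
    hence "(p + q) * ln p \<le> p * ln \<bar>p\<bar> + q * ln \<bar>q\<bar>"
      using False p by (simp add: algebra_simps)
    moreover have "2 * \<delta> * ln \<delta> \<le> 2 * \<delta> * ln p"
      using p assms by (intro mult_left_mono ln_mono) auto
    ultimately show ?thesis using pq by simp
  qed
  show ?thesis using *[of p q] *[of q p] assms by (cases "p \<ge> q") (auto simp: add_ac)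
qed

text \<open>The antiderivative at the endpoints gives at least
  \<open>2 * \<delta> * ln \<delta> - 2 * \<delta>\<close>, the source of the logarithm of
  \<open>e / \<delta>\<close>. Naming the value \<open>I\<close> keeps integrability and bound
  together for the sum over all zeros.\<close>

lemma integral_ln_abs_ge:
  fixes T \<gamma> \<delta> :: real
  assumes "\<delta> > 0"
  shows "\<exists>I \<ge> - (2 * \<delta> * ln (exp 1 / \<delta>)). ((\<lambda>t. ln \<bar>t - \<gamma>\<bar>) has_integral I) {T - \<delta>..T + \<delta>}"
proof (intro exI conjI)
  show "((\<lambda>t. ln \<bar>t - \<gamma>\<bar>) has_integral
     ((T + \<delta> - \<gamma>) * ln \<bar>T + \<delta> - \<gamma>\<bar> - (T + \<delta> - \<gamma>) -
       ((T - \<delta> - \<gamma>) * ln \<bar>T - \<delta> - \<gamma>\<bar> - (T - \<delta> - \<gamma>)))) {T - \<delta>..T + \<delta>}"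
    using assms by (intro has_integral_ln_abs) auto
  have "2 * \<delta> * ln \<delta> \<le> (T + \<delta> - \<gamma>) * ln \<bar>T + \<delta> - \<gamma>\<bar> + (\<gamma> - (T - \<delta>)) * ln \<bar>\<gamma> - (T - \<delta>)\<bar>"
    using assms by (intro x_ln_x_midpoint) auto
  moreover have "\<bar>\<gamma> - (T - \<delta>)\<bar> = \<bar>T - \<delta> - \<gamma>\<bar>" by simp
  moreover have "2 * \<delta> * ln (exp 1 / \<delta>) = 2 * \<delta> - 2 * \<delta> * ln \<delta>"
    using assms by (simp add: ln_div algebra_simps)
  ultimately show "- (2 * \<delta> * ln (exp 1 / \<delta>)) \<le>
     (T + \<delta> - \<gamma>) * ln \<bar>T + \<delta> - \<gamma>\<bar> - (T + \<delta> - \<gamma>) -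
       ((T - \<delta> - \<gamma>) * ln \<bar>T - \<delta> - \<gamma>\<bar> - (T - \<delta> - \<gamma>))"
    by (simp add: algebra_simps)
qed

lemma integral_sum_ln_abs_ge:
  fixes T \<delta> :: real
  assumes "\<delta> > 0"
  shows "\<exists>I \<ge> - (2 * \<delta> * (real (length gs) * ln (exp 1 / \<delta>))).
           ((\<lambda>t. \<Sum>\<gamma>\<leftarrow>gs. ln \<bar>t - \<gamma>\<bar>) has_integral I) {T - \<delta>..T + \<delta>}"
proof (induction gs)
  case (Cons \<gamma> gs)
  then obtain I where I: "I \<ge> - (2 * \<delta> * (real (length gs) * ln (exp 1 / \<delta>)))"
    "((\<lambda>t. \<Sum>\<gamma>\<leftarrow>gs. ln \<bar>t - \<gamma>\<bar>) has_integral I) {T - \<delta>..T + \<delta>}" by blast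
  obtain J where J: "J \<ge> - (2 * \<delta> * ln (exp 1 / \<delta>))"
    "((\<lambda>t. ln \<bar>t - \<gamma>\<bar>) has_integral J) {T - \<delta>..T + \<delta>}"
    using integral_ln_abs_ge[OF assms] by blast
  show ?case
    using has_integral_add[OF J(2) I(2)] I(1) J(1)
    by (intro exI[of _ "J + I"]) (simp add: algebra_simps)
qed (auto intro!: exI[of _ 0])

lemma ln_prod_list:
  fixes f :: "'a \<Rightarrow> real"
  assumes "\<And>x. x \<in> set xs \<Longrightarrow> f x > 0"
  shows "(\<Prod>x\<leftarrow>xs. f x) = exp (\<Sum>x\<leftarrow>xs. ln (f x))"
  using assms by (induction xs) (simp_all add: exp_add)

text \<open>
  Jensen's inequality for the exponential function, in the form of the tangent inequality
  \<open>exp (k * w) \<ge> exp (k * a) * (1 + k * (w - a))\<close> at a lower bound \<open>a\<close> of the mean of the logarithm.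
\<close>

lemma integral_powr_ge:
  fixes F :: "real \<Rightarrow> real"
  assumes cont: "continuous_on {T - \<delta>..T + \<delta>} F" and "\<delta> > 0" "k > 0"
    and nonneg: "\<And>t. t \<in> {T - \<delta>..T + \<delta>} \<Longrightarrow> F t \<ge> 0"
    and lower: "\<And>t. t \<in> {T - \<delta>..T + \<delta>} \<Longrightarrow> exp (- B) * (\<Prod>\<gamma>\<leftarrow>gs. \<bar>t - \<gamma>\<bar>) \<le> F t"
  shows "2 * \<delta> * exp (- (k * (B + real (length gs) * ln (exp 1 / \<delta>)))) \<le>
           integral {T - \<delta>..T + \<delta>} (\<lambda>t. F t powr k)"
proof -
  \<comment> \<open>A lower bound for the mean of \<open>S t - B\<close>, the exponent of the lower
    bound for \<open>F\<close>.\<close>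
  define a where "a = - (B + real (length gs) * ln (exp 1 / \<delta>))"
  define S where "S = (\<lambda>t. \<Sum>\<gamma>\<leftarrow>gs. ln \<bar>t - \<gamma>\<bar>)"
  define w where "w = (\<lambda>t. exp (k * a) * (1 + k * (S t - B - a)))"
  \<comment> \<open>At a point of \<open>gs\<close> the value \<open>ln 0 = 0\<close> may make
    \<open>w\<close> exceed \<open>F t powr k\<close>; resetting these finitely many values leaves
    the integral unchanged.\<close>
  define w' where "w' = (\<lambda>t. if t \<in> set gs then 0 else w t)"
  obtain I where I: "I \<ge> - (2 * \<delta> * (real (length gs) * ln (exp 1 / \<delta>)))"
    "(S has_integral I) {T - \<delta>..T + \<delta>}"
    using integral_sum_ln_abs_ge[OF assms(2)] unfolding S_def by blast
  have const: "((\<lambda>t. c) has_integral (2 * \<delta> * c)) {T - \<delta>..T + \<delta>}" for c :: real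
    using has_integral_const_real[of c "T - \<delta>" "T + \<delta>"] assms by simp
  have "(w has_integral (exp (k * a) * (2 * \<delta> * 1 + k * (I - 2 * \<delta> * B - 2 * \<delta> * a)))) {T - \<delta>..T + \<delta>}"
    unfolding w_def
    by (intro has_integral_mult_right has_integral_add has_integral_diff const I)
  hence w': "(w' has_integral (exp (k * a) * (2 * \<delta> * 1 + k * (I - 2 * \<delta> * B - 2 * \<delta> * a)))) {T - \<delta>..T + \<delta>}"
    by (rule has_integral_spike_finite[of "set gs", rotated 2]) (auto simp: w'_def)
  have "continuous_on {T - \<delta>..T + \<delta>} (\<lambda>t. F t powr k)"
    using cont nonneg \<open>k > 0\<close> by (intro continuous_on_powr') auto
  hence int: "(\<lambda>t. F t powr k) integrable_on {T - \<delta>..T + \<delta>}"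
    by (rule integrable_continuous_real)
  \<comment> \<open>By the choice of \<open>a\<close> the linear term of the tangent has nonnegative
    integral, so the constant term alone gives the bound.\<close>
  have "0 \<le> I - 2 * \<delta> * B - 2 * \<delta> * a"
    using I(1) by (simp add: a_def algebra_simps)
  hence "0 \<le> k * (I - 2 * \<delta> * B - 2 * \<delta> * a)"
    using \<open>k > 0\<close> by simp
  hence "exp (k * a) * (2 * \<delta>) \<le> exp (k * a) * (2 * \<delta> * 1 + k * (I - 2 * \<delta> * B - 2 * \<delta> * a))"
    by (intro mult_left_mono) auto
  also have "\<dots> \<le> integral {T - \<delta>..T + \<delta>} (\<lambda>t. F t powr k)"
  proof (rule has_integral_le[OF w' integrable_integral[OF int]])
    fix t assume t: "t \<in> {T - \<delta>..T + \<delta>}"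
    show "w' t \<le> F t powr k"
    proof (cases "t \<in> set gs")
      case False
      have "exp (- B) * (\<Prod>\<gamma>\<leftarrow>gs. \<bar>t - \<gamma>\<bar>) = exp (S t - B)"
        using False unfolding S_def by (subst ln_prod_list) (auto simp: exp_diff exp_minus field_simps)
      hence le: "exp (S t - B) \<le> F t" using lower[OF t] by simp
      have "w t \<le> exp (k * a) * exp (k * (S t - B - a))"
        unfolding w_def by (intro mult_left_mono exp_ge_add_one_self) auto
      also have "\<dots> = exp (S t - B) powr k"
        by (simp add: powr_def algebra_simps flip: exp_add)
      also have "\<dots> \<le> F t powr k"
        using le \<open>k > 0\<close> by (intro powr_mono2) auto
      finally show ?thesis using False by (simp add: w'_def)
    qed (simp add: w'_def)
  qed
  also have "k * a = - (k * (B + real (length gs) * ln (exp 1 / \<delta>)))" by (simp add: a_def algebra_simps)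
  finally show ?thesis by (simp only: mult_ac)
qed

theorem theorem3:
  shows "\<exists>C::real. \<exists>T\<^sub>0::real. C > 0 \<and> T\<^sub>0 > 0 \<and>
    (\<forall>(k::real) (\<sigma>::real) (\<delta>::real) (T::real).
       k > 0 \<longrightarrow> 1/2 \<le> \<sigma> \<longrightarrow> \<sigma> \<le> 1 \<longrightarrow> 0 < \<delta> \<longrightarrow> \<delta> \<le> 1/2 \<longrightarrow> T \<ge> T\<^sub>0 \<longrightarrow>
       integral {T - \<delta>..T + \<delta>} (\<lambda>t. cmod (zeta (Complex \<sigma> t)) powr k)
         \<ge> 2 * \<delta> * T powr (- C * k * ln (exp 1 / \<delta>)))"
proof -
  obtain C T0 where C: "C > 0" "T0 \<ge> 3" and main:
    "\<And>T. T \<ge> T0 \<Longrightarrow> \<exists>gs. real (length gs) \<le> C * ln T \<and>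
     (\<forall>\<sigma> t. 1 / 2 \<le> \<sigma> \<longrightarrow> \<sigma> \<le> 1 \<longrightarrow> \<bar>t - T\<bar> \<le> 1 / 2 \<longrightarrow>
        exp (- (C * ln T)) * (\<Prod>\<gamma>\<leftarrow>gs. \<bar>t - \<gamma>\<bar>) \<le> norm (zeta (Complex \<sigma> t)))"
    using zeta_lower_bound_by_zeros by metis
  show ?thesis
  \<comment> \<open>One \<open>C\<close> accounts for the zeros and one for the factor
    \<open>exp (- (C * ln T))\<close>, which is absorbed because \<open>l \<ge> 1\<close>.\<close>
  proof (rule exI[of _ "2 * C"], rule exI[of _ T0], intro conjI allI impI)
    show "2 * C > 0" "T0 > 0" using C by simp_all
    fix k \<sigma> \<delta> T :: real
    assume k: "k > 0" and \<sigma>: "1/2 \<le> \<sigma>" "\<sigma> \<le> 1" and \<delta>: "0 < \<delta>" "\<delta> \<le> 1/2" and T: "T \<ge> T0"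
    obtain gs where gs: "real (length gs) \<le> C * ln T"
      "\<And>t. \<bar>t - T\<bar> \<le> 1 / 2 \<Longrightarrow>
        exp (- (C * ln T)) * (\<Prod>\<gamma>\<leftarrow>gs. \<bar>t - \<gamma>\<bar>) \<le> norm (zeta (Complex \<sigma> t))"
      using main[OF T] \<sigma> by blast
    define l where "l = ln (exp 1 / \<delta>)"
    have l: "l \<ge> 1" using \<delta> by (simp add: l_def ln_div)
    have lnT: "C * ln T \<ge> 0" using C T by simp
    have near: "\<bar>t - T\<bar> \<le> 1 / 2" if "T - \<delta> \<le> t" "t \<le> T + \<delta>" for t
      unfolding abs_le_iff using that \<delta> by linarith
    have "continuous_on {T - \<delta>..T + \<delta>} (\<lambda>t. zeta (Complex \<sigma> t))"
    proof (rule continuous_on_compose2[OF holomorphic_on_imp_continuous_on[OF holomorphic_zeta]])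
      show "continuous_on {T - \<delta>..T + \<delta>} (Complex \<sigma>)"
        unfolding Complex_eq by (intro continuous_intros)
      \<comment> \<open>\<open>T0 \<ge> 3\<close> and \<open>\<delta> \<le> 1/2\<close> keep the
        segment above the real axis, away from the pole.\<close>
      show "Complex \<sigma> ` {T - \<delta>..T + \<delta>} \<subseteq> - {1}"
        using C T \<delta> by (auto simp: complex_eq_iff)
    qed
    hence "2 * \<delta> * exp (- (k * (C * ln T + real (length gs) * l))) \<le>
        integral {T - \<delta>..T + \<delta>} (\<lambda>t. cmod (zeta (Complex \<sigma> t)) powr k)"
      unfolding l_def using \<delta> k
      by (intro integral_powr_ge gs continuous_on_norm near) auto
    moreover have "2 * \<delta> * T powr (- (2 * C) * k * l) \<le>
        2 * \<delta> * exp (- (k * (C * ln T + real (length gs) * l)))"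
    proof -
      have "real (length gs) * l \<le> C * ln T * l"
        using gs(1) l by (intro mult_right_mono) auto
      moreover have "C * ln T * 1 \<le> C * ln T * l"
        using l lnT by (intro mult_left_mono)
      ultimately have "k * (C * ln T + real (length gs) * l) \<le> k * (2 * (C * ln T * l))"
        using k by (intro mult_left_mono) auto
      thus ?thesis using T C \<delta> by (simp add: powr_def mult_ac)
    qed
    ultimately show "2 * \<delta> * T powr (- (2 * C) * k * ln (exp 1 / \<delta>)) \<le>
        integral {T - \<delta>..T + \<delta>} (\<lambda>t. cmod (zeta (Complex \<sigma> t)) powr k)"
      unfolding l_def by linarith
  qed
qed

end
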